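(* Fix $i\in\{1,2,3\}$ and constants $\sigma>0,\lambda>0,\rho>0$ with $\rho^{-2}\sigma<1$ and $\rho\le\lambda-2\rho^{-1}\sigma(1-\rho^{-2}\sigma)^{-1}$. (1) If $\Theta_{1,i}$ satisfies $\Theta_{1,i}^{12}\Theta_{1,i}^{21}\le\sigma I$, $\Theta_{1,i}^{21}\Theta_{1,i}^{12}\le\sigma I$, $\Theta_{1,i}^{11}+\Theta_{1,i}^{22}\ge\lambda I$, then the sequence $\{\Theta_{k,i}\}_{k\ge1}$ converges to a block diagonal matrix $\Theta_{\infty,i}=\mathrm{diag}(\Theta_{\infty,i}^{11},\Theta_{\infty,i}^{22})$ with $\Theta_{\infty,i}^{11}+\Theta_{\infty,i}^{22}\ge\rho I$. (2) In the case $i=3$ with $m<n$, if $\Theta_{n,3}$ satisfies these three inequalities, then $\{\Theta_{k,3}\}_{k\ge n}$ converges to a block diagonal matrix $\Theta_{\infty,3}=\mathrm{diag}(\Theta_{\infty,3}^{11},\Theta_{\infty,3}^{22})$ with $\Theta_{\infty,3}^{11}+\Theta_{\infty,3}^{22}\ge\rho I$.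
   Context: Consider $x_{k+1}=Ax_k+Bw_k$ with $x_k\in\mathbb{R}^n$, $w_k\in\mathbb{R}^m$, $(A,B)$ controllable, $\mathrm{rank}(B)=m\le n$, running payoff $\tfrac12x^T\Phi x-\tfrac{\gamma^2}{2}|w|^2$ ($\Phi=\Phi^T>0$), and $k$-step dynamic programming operator $\mathcal{S}_k$ (the $k$-fold composition of $(\mathcal{S}_1\phi)(x)=\sup_w\{\tfrac12x^T\Phi x-\tfrac{\gamma^2}{2}|w|^2+\phi(Ax+Bw)\}$). With basis functions $\psi^1(x,z)=z^Tx$, $\psi^2(x,z)=-\tfrac12(x-z)^TM(x-z)$ ($M=M^T>0$), $\psi^3(x,z)=\delta(x-z)$ ($\delta(0)=0$, $-\infty$ otherwise), set $\mathrm{S}_{k,i}(x,z)=(\mathcal{S}_k\psi^i(\cdot,z))(x)$ and $\mathrm{B}_{k,i}(y,z)=-\sup_x\{\psi^i(x,y)-\mathrm{S}_{k,i}(x,z)\}=-\tfrac12[y;z]^T\Theta_{k,i}[y;z]$, $\Theta_{k,i}$ symmetric with $n\times n$ blocks $\Theta_{k,i}^{jl}$. For $i=3$ and $m<n$, $\mathrm{S}_{k,3}$ is only finite quadratic for $k\ge n$ (it is the optimal payoff over controls steering $x$ to $z$ in $k$ steps), so the sequence starts at $k=n$. The matrices satisfy $\Theta_{k_1+k_2,i}=\Theta_{k_1,i}\circledast\Theta_{k_2,i}$ with $\Omega_1\circledast\Omega_2=\begin{bmatrix}\Omega_1^{11}&0\\0&\Omega_2^{22}\end{bmatrix}-\begin{bmatrix}\Omega_1^{12}\\\Omega_2^{21}\end{bmatrix}(\Omega_1^{22}+\Omega_2^{11})^{-1}\begin{bmatrix}\Omega_1^{21}&\Omega_2^{12}\end{bmatrix}$.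 *)

theory Defs
  imports "HOL-Analysis.Analysis"
begin

text \<open>System x_{k+1} = A x_k + B w_k, x in R^n (index type 'n), w in R^m (index type 'm).\<close>

definition controllable :: "real^'n^'n \<Rightarrow> real^'m^'n \<Rightarrow> bool" where
  "controllable A B \<longleftrightarrow>
     span (\<Union>k\<in>{..<CARD('n)}. range (\<lambda>w::real^'m. (((*v) A) ^^ k) (B *v w))) = UNIV"

definition pos_def :: "real^'n^'n \<Rightarrow> bool" where
  "pos_def P \<longleftrightarrow> transpose P = P \<and> (\<forall>v. v \<noteq> 0 \<longrightarrow> 0 < v \<bullet> (P *v v))"

text \<open>Loewner order P \<le> Q on (symmetric) matrices.\<close>
definition loewner_le :: "real^'n^'n \<Rightarrow> real^'n^'n \<Rightarrow> bool" where
  "loewner_le P Q \<longleftrightarrow> (\<forall>v. v \<bullet> (P *v v) \<le> v \<bullet> (Q *v v))"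

text \<open>One-step dynamic programming operator (extended-real valued functions).\<close>
definition S1 :: "real^'n^'n \<Rightarrow> real \<Rightarrow> real^'n^'n \<Rightarrow> real^'m^'n
                  \<Rightarrow> (real^'n \<Rightarrow> ereal) \<Rightarrow> real^'n \<Rightarrow> ereal" where
  "S1 \<Phi> \<gamma> A B \<phi> x =
     (SUP w::real^'m. ereal (1/2 * (x \<bullet> (\<Phi> *v x)) - \<gamma>\<^sup>2 / 2 * (norm w)\<^sup>2) + \<phi> (A *v x + B *v w))"

definition Sk :: "nat \<Rightarrow> real^'n^'n \<Rightarrow> real \<Rightarrow> real^'n^'n \<Rightarrow> real^'m^'n
                  \<Rightarrow> (real^'n \<Rightarrow> ereal) \<Rightarrow> real^'n \<Rightarrow> ereal" where
  "Sk k \<Phi> \<gamma> A B = (S1 \<Phi> \<gamma> A B) ^^ k"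

text \<open>Basis functions psi^1, psi^2, psi^3 (psi i M x z).\<close>
definition psi :: "nat \<Rightarrow> real^'n^'n \<Rightarrow> real^'n \<Rightarrow> real^'n \<Rightarrow> ereal" where
  "psi i M x z =
     (if i = 1 then ereal (z \<bullet> x)
      else if i = 2 then ereal (- (1/2) * ((x - z) \<bullet> (M *v (x - z))))
      else (if x = z then 0 else - \<infinity>))"

text \<open>S_{k,i}(x,z) = (S_k psi^i(.,z))(x).\<close>
definition Ski :: "nat \<Rightarrow> nat \<Rightarrow> real^'n^'n \<Rightarrow> real \<Rightarrow> real^'n^'n \<Rightarrow> real^'m^'n
                   \<Rightarrow> real^'n^'n \<Rightarrow> real^'n \<Rightarrow> real^'n \<Rightarrow> ereal" where
  "Ski k i \<Phi> \<gamma> A B M x z = Sk k \<Phi> \<gamma> A B (\<lambda>x'. psi i M x' z) x"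

text \<open>B_{k,i}(y,z) = - sup_x { psi^i(x,y) - S_{k,i}(x,z) }.\<close>
definition Bki :: "nat \<Rightarrow> nat \<Rightarrow> real^'n^'n \<Rightarrow> real \<Rightarrow> real^'n^'n \<Rightarrow> real^'m^'n
                   \<Rightarrow> real^'n^'n \<Rightarrow> real^'n \<Rightarrow> real^'n \<Rightarrow> ereal" where
  "Bki k i \<Phi> \<gamma> A B M y z = - (SUP x. psi i M x y - Ski k i \<Phi> \<gamma> A B M x z)"

text \<open>2n x 2n matrices indexed by 'n + 'n; stacked vector [y;z].\<close>
definition stack :: "real^'n \<Rightarrow> real^'n \<Rightarrow> real^('n::finite + 'n)" where
  "stack y z = (\<chi> i. case i of Inl j \<Rightarrow> y $ j | Inr j \<Rightarrow> z $ j)"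

definition blk11 :: "real^('n::finite+'n)^('n+'n) \<Rightarrow> real^'n^'n" where
  "blk11 T = (\<chi> i j. T $ Inl i $ Inl j)"
definition blk12 :: "real^('n::finite+'n)^('n+'n) \<Rightarrow> real^'n^'n" where
  "blk12 T = (\<chi> i j. T $ Inl i $ Inr j)"
definition blk21 :: "real^('n::finite+'n)^('n+'n) \<Rightarrow> real^'n^'n" where
  "blk21 T = (\<chi> i j. T $ Inr i $ Inl j)"
definition blk22 :: "real^('n::finite+'n)^('n+'n) \<Rightarrow> real^'n^'n" where
  "blk22 T = (\<chi> i j. T $ Inr i $ Inr j)"

definition mk_blocks :: "real^'n^'n \<Rightarrow> real^'n^'n \<Rightarrow> real^'n^'n \<Rightarrow> real^'n^'n
                         \<Rightarrow> real^('n::finite+'n)^('n+'n)" where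
  "mk_blocks P Q R S = (\<chi> i j. case i of
       Inl a \<Rightarrow> (case j of Inl b \<Rightarrow> P $ a $ b | Inr b \<Rightarrow> Q $ a $ b)
     | Inr a \<Rightarrow> (case j of Inl b \<Rightarrow> R $ a $ b | Inr b \<Rightarrow> S $ a $ b))"

text \<open>The operation Omega_1 \<circledast> Omega_2.\<close>
definition star_op :: "real^('n::finite+'n)^('n+'n) \<Rightarrow> real^('n::finite+'n)^('n+'n) \<Rightarrow> real^('n::finite+'n)^('n+'n)" where
  "star_op O1 O2 =
     (let Inv = matrix_inv (blk22 O1 + blk11 O2) in
      mk_blocks (blk11 O1 - blk12 O1 ** Inv ** blk21 O1)
                (- (blk12 O1 ** Inv ** blk12 O2))
                (- (blk21 O2 ** Inv ** blk21 O1))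
                (blk22 O2 - blk21 O2 ** Inv ** blk12 O2))"

text \<open>B_{k,i} is the quadratic form -1/2 [y;z]^T T [y;z] with T symmetric.\<close>
definition is_Theta :: "nat \<Rightarrow> nat \<Rightarrow> real^'n^'n \<Rightarrow> real \<Rightarrow> real^'n^'n \<Rightarrow> real^'m^'n
                        \<Rightarrow> real^'n^'n \<Rightarrow> real^('n::finite+'n)^('n+'n) \<Rightarrow> bool" where
  "is_Theta k i \<Phi> \<gamma> A B M T \<longleftrightarrow> transpose T = T \<and>
     (\<forall>y z. Bki k i \<Phi> \<gamma> A B M y z = ereal (- (1/2) * (stack y z \<bullet> (T *v stack y z))))"

definition Theta :: "nat \<Rightarrow> nat \<Rightarrow> real^'n^'n \<Rightarrow> real \<Rightarrow> real^'n^'n \<Rightarrow> real^'m^'n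
                     \<Rightarrow> real^'n^'n \<Rightarrow> real^('n::finite+'n)^('n+'n)" where
  "Theta k i \<Phi> \<gamma> A B M = (THE T. is_Theta k i \<Phi> \<gamma> A B M T)"

text \<open>The three hypotheses on a matrix T (with constants sigma, lambda).\<close>
definition Theta_hyps :: "real \<Rightarrow> real \<Rightarrow> real^('n::finite+'n)^('n+'n) \<Rightarrow> bool" where
  "Theta_hyps \<sigma> lam T \<longleftrightarrow>
     loewner_le (blk12 T ** blk21 T) (mat \<sigma>) \<and>
     loewner_le (blk21 T ** blk12 T) (mat \<sigma>) \<and>
     loewner_le (mat lam) (blk11 T + blk22 T)"

text \<open>Standing facts of the setting, from index k0 on: Theta_{k,i} exists (B_{k,i} is
  quadratic) and Theta_{k1+k2,i} = Theta_{k1,i} \<circledast> Theta_{k2,i} (with the inverse existing).\<close>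
definition standing :: "nat \<Rightarrow> nat \<Rightarrow> real^'n^'n \<Rightarrow> real \<Rightarrow> real^'n^'n \<Rightarrow> real^'m^'n
                        \<Rightarrow> real^'n^'n \<Rightarrow> bool" where
  "standing k0 i \<Phi> \<gamma> A B M \<longleftrightarrow>
     (\<forall>k\<ge>k0. \<exists>T. is_Theta k i \<Phi> \<gamma> A B M T) \<and>
     (\<forall>k1\<ge>k0. \<forall>k2\<ge>k0.
        invertible (blk22 (Theta k1 i \<Phi> \<gamma> A B M) + blk11 (Theta k2 i \<Phi> \<gamma> A B M)) \<and>
        Theta (k1 + k2) i \<Phi> \<gamma> A B M =
          star_op (Theta k1 i \<Phi> \<gamma> A B M) (Theta k2 i \<Phi> \<gamma> A B M))"

text \<open>Conclusion: convergence to a block-diagonal limit with Theta^11 + Theta^22 \<ge> rho I.\<close>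
definition conv_blockdiag :: "real \<Rightarrow> (nat \<Rightarrow> real^('n::finite+'n)^('n+'n)) \<Rightarrow> bool" where
  "conv_blockdiag \<rho> Th \<longleftrightarrow>
     (\<exists>L11 L22. Th \<longlonglongrightarrow> mk_blocks L11 0 0 L22 \<and> loewner_le (mat \<rho>) (L11 + L22))"

end

theory Submission
  imports Defs
begin

text \<open>
  Let \<open>U\<^sub>j\<close> be the \<open>(j+1)\<close>-st \<open>\<circledast>\<close>-power of the first matrix of the sequence.
  As long as the matrices inverted in \<open>U\<^sub>j \<circledast> U\<^sub>0\<close> and \<open>U\<^sub>0 \<circledast> U\<^sub>j\<close> are \<open>\<ge> \<rho> I\<close>, the
  off-diagonal blocks shrink by the factor \<open>\<surd>\<sigma> / \<rho> < 1\<close>, and each diagonal block decreases by at most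
  \<open>(\<sigma> / \<rho>) (\<sigma> / \<rho>\<^sup>2)\<^sup>j I\<close>. Summing the geometric series, a diagonal block never drops by more
  than \<open>(\<sigma> / \<rho>) / (1 - \<sigma> / \<rho>\<^sup>2)\<close>, so the condition on \<open>\<rho>\<close> keeps the inverted matrices and the
  sums of the diagonal blocks \<open>\<ge> \<rho> I\<close>.

  When the sequence starts at \<open>n > 1\<close>, this only controls the indices divisible by \<open>n\<close>. Since an
  optimal trajectory may wait at the origin, the diagonal blocks are decreasing in \<open>k\<close> for
  \<open>i = 3\<close>; hence the lower bound extends to all indices, the diagonal blocks converge, and the
  off-diagonal blocks contract from \<open>k\<close> to \<open>k + n\<close>.
\<close>

section \<open>Quadratic forms, coercivity and the Loewner order\<close>

lemma inner_mat_vec: "v \<bullet> (mat r *v v) = r * (norm v)\<^sup>2" for v :: "real^'n"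
proof -
  have "mat r *v v = r *s v"
    by (simp add: vec_eq_iff matrix_vector_mult_def mat_def if_distrib[where f="\<lambda>x. x * _"] cong: if_cong)
  then show ?thesis
    by (simp add: scalar_mult_eq_scaleR power2_norm_eq_inner)
qed

lemma inner_transpose_mult_vec: "x \<bullet> (transpose C *v y) = (C *v x) \<bullet> y" for C :: "real^'n^'m"
  by (metis dot_lmul_matrix inner_commute transpose_matrix_vector transpose_transpose)

text \<open>Polarization: a symmetric matrix is determined by its quadratic form. This turns
  convergence of forms into convergence of entries, and equality of forms into equality of
  matrices.\<close>

lemma symmetric_entry_polarization:
  fixes X :: "real^'n^'n"
  assumes "transpose X = X"
  shows "X $ i $ j = ((axis i 1 + axis j 1) \<bullet> (X *v (axis i 1 + axis j 1))
            - axis i 1 \<bullet> (X *v axis i 1) - axis j 1 \<bullet> (X *v axis j 1)) / 2"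
proof -
  have e: "axis a 1 \<bullet> (X *v axis b 1) = X $ a $ b" for a b
    by (simp add: matrix_vector_mul_component inner_axis inner_axis')
  have "X $ j $ i = X $ i $ j"
    using arg_cong[OF assms, of "\<lambda>Y. Y $ i $ j"] by (simp add: transpose_def)
  then show ?thesis
    by (simp add: matrix_vector_right_distrib inner_add_left inner_add_right e)
qed

text \<open>Coercivity leaves \<open>S\<close> no kernel, so \<open>w = matrix_inv S *v u\<close>
  solves \<open>S *v w = u\<close>. All three bounds are read off the chain \<open>r * (norm
  w)\<^sup>2 \<le> w \<bullet> u \<le> norm w * norm u\<close>.\<close>

lemma coercive_matrix_inv:
  fixes S :: "real^'n^'n"
  assumes S: "loewner_le (mat r) S" and r: "r > 0"
  shows "0 \<le> u \<bullet> (matrix_inv S *v u)"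
    and "u \<bullet> (matrix_inv S *v u) \<le> (norm u)\<^sup>2 / r"
    and "norm (matrix_inv S *v u) \<le> norm u / r"
proof -
  have coer: "r * (norm v)\<^sup>2 \<le> v \<bullet> (S *v v)" for v
    using S by (simp add: loewner_le_def inner_mat_vec)
  have "v = 0" if "S *v v = 0" for v
    using coer[of v] r that by (simp add: mult_le_0_iff)
  then obtain S' where "S' ** S = mat 1"
    using matrix_left_invertible_ker[of S] by blast
  then have "invertible S"
    using invertible_left_inverse by blast
  then have "S ** matrix_inv S = mat 1"
    unfolding invertible_def matrix_inv_def by (rule someI2_ex) blast
  define w where "w = matrix_inv S *v u"
  have Sw: "S *v w = u"
    by (simp add: w_def matrix_vector_mul_assoc \<open>S ** matrix_inv S = mat 1\<close>)
  have c: "r * (norm w)\<^sup>2 \<le> w \<bullet> u"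
    using coer[of w] Sw by simp
  have cs: "w \<bullet> u \<le> norm w * norm u"
    by (rule norm_cauchy_schwarz)
  have "0 \<le> r * (norm w)\<^sup>2"
    using r by simp
  with c show "0 \<le> u \<bullet> (matrix_inv S *v u)"
    by (simp add: w_def[symmetric] inner_commute)
  have "norm w * (r * norm w) \<le> norm w * norm u"
    using c cs by (simp add: power2_eq_square algebra_simps)
  then have "r * norm w \<le> norm u"
    by (cases "w = 0") simp_all
  then have nw: "norm w \<le> norm u / r"
    using r by (simp add: field_simps)
  then show "norm (matrix_inv S *v u) \<le> norm u / r"
    by (simp add: w_def)
  have "norm w * norm u \<le> (norm u / r) * norm u"
    using nw by (rule mult_right_mono) simp
  with cs show "u \<bullet> (matrix_inv S *v u) \<le> (norm u)\<^sup>2 / r"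
    by (simp add: w_def[symmetric] inner_commute power2_eq_square)
qed

lemma loewner_le_trans: "loewner_le P Q \<Longrightarrow> loewner_le Q R \<Longrightarrow> loewner_le P R"
  unfolding loewner_le_def using order_trans by blast

text \<open>For each fixed \<open>v\<close> the form is a decreasing real sequence bounded below,
  hence convergent; polarization expresses every entry through three such sequences.\<close>

lemma loewner_decseq_convergent:
  fixes X :: "nat \<Rightarrow> real^'n^'n"
  assumes sym: "\<And>k. transpose (X k) = X k"
    and dec: "\<And>k. loewner_le (X (Suc k)) (X k)"
    and below: "\<And>k. loewner_le Y (X k)"
  obtains L where "X \<longlonglongrightarrow> L"
proof -
  define l where "l v = lim (\<lambda>k. v \<bullet> (X k *v v))" for v
  have l: "(\<lambda>k. v \<bullet> (X k *v v)) \<longlonglongrightarrow> l v" for v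
  proof -
    have "decseq (\<lambda>k. v \<bullet> (X k *v v))"
      using dec by (auto intro!: decseq_SucI simp: loewner_le_def)
    then have "convergent (\<lambda>k. v \<bullet> (X k *v v))"
      using decseq_convergent[where B = "v \<bullet> (Y *v v)"] below
      by (metis convergentI loewner_le_def)
    then show ?thesis
      by (simp add: l_def convergent_LIMSEQ_iff)
  qed
  define L :: "real^'n^'n" where
    "L = (\<chi> i j. (l (axis i 1 + axis j 1) - l (axis i 1) - l (axis j 1)) / 2)"
  have "(\<lambda>k. X k $ i $ j) \<longlonglongrightarrow> L $ i $ j" for i j
    unfolding L_def symmetric_entry_polarization[OF sym] by (simp, intro tendsto_intros l) simp
  then have "X \<longlonglongrightarrow> L"
    by (intro vec_tendstoI) 
  then show ?thesis ..
qed

section \<open>Block matrices\<close>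

lemma blk_mk_blocks [simp]:
  "blk11 (mk_blocks P Q R S) = P" "blk12 (mk_blocks P Q R S) = Q"
  "blk21 (mk_blocks P Q R S) = R" "blk22 (mk_blocks P Q R S) = S"
  by (simp_all add: blk11_def blk12_def blk21_def blk22_def mk_blocks_def vec_eq_iff)

lemma mk_blocks_blk: "mk_blocks (blk11 T) (blk12 T) (blk21 T) (blk22 T) = T"
  by (simp add: blk11_def blk12_def blk21_def blk22_def mk_blocks_def vec_eq_iff split: sum.split)

lemma symmetric_blocks:
  assumes "transpose T = T"
  shows "transpose (blk11 T) = blk11 T" "transpose (blk22 T) = blk22 T"
    "blk12 T = transpose (blk21 T)" "blk21 T = transpose (blk12 T)"
proof -
  have "T $ i $ j = T $ j $ i" for i j
    using arg_cong[OF assms, of "\<lambda>Y. Y $ j $ i"] by (simp add: transpose_def)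
  then show "transpose (blk11 T) = blk11 T" "transpose (blk22 T) = blk22 T"
    "blk12 T = transpose (blk21 T)" "blk21 T = transpose (blk12 T)"
    by (simp_all add: blk11_def blk12_def blk21_def blk22_def transpose_def vec_eq_iff)
qed

lemma tendsto_mk_blocks:
  assumes "(P \<longlongrightarrow> P') F" "(Q \<longlongrightarrow> Q') F" "(R \<longlongrightarrow> R') F" "(S \<longlongrightarrow> S') F"
  shows "((\<lambda>x. mk_blocks (P x) (Q x) (R x) (S x)) \<longlongrightarrow> mk_blocks P' Q' R' S') F"
  unfolding mk_blocks_def
  by (intro vec_tendstoI) (auto intro!: tendsto_intros assms split: sum.split)

section \<open>One star product with a coercive inverted matrix\<close>

context
  fixes T1 T2 :: "real^('n::finite+'n)^('n+'n)" and r :: real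
  assumes T1: "transpose T1 = T1" and T2: "transpose T2 = T2"
    and coer: "loewner_le (mat r) (blk22 T1 + blk11 T2)" and r: "r > 0"
begin

private abbreviation "Inv \<equiv> matrix_inv (blk22 T1 + blk11 T2)"

text \<open>By symmetry \<open>blk12 T1\<close> is the transpose of \<open>blk21 T1\<close>, so the
  subtracted term is the form of \<open>Inv\<close> at \<open>blk21 T1 *v v\<close>, where the
  bounds for coercive inverses apply.\<close>

private lemma star11: "v \<bullet> (blk11 (star_op T1 T2) *v v)
    = v \<bullet> (blk11 T1 *v v) - (blk21 T1 *v v) \<bullet> (Inv *v (blk21 T1 *v v))"
  using inner_transpose_mult_vec[of v "blk21 T1" "Inv *v (blk21 T1 *v v)"] symmetric_blocks(3)[OF T1]
  by (simp add: star_op_def Let_def matrix_vector_mult_diff_rdistrib inner_diff_right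
      flip: matrix_vector_mul_assoc)

private lemma star22: "v \<bullet> (blk22 (star_op T1 T2) *v v)
    = v \<bullet> (blk22 T2 *v v) - (blk12 T2 *v v) \<bullet> (Inv *v (blk12 T2 *v v))"
  using inner_transpose_mult_vec[of v "blk12 T2" "Inv *v (blk12 T2 *v v)"] symmetric_blocks(4)[OF T2]
  by (simp add: star_op_def Let_def matrix_vector_mult_diff_rdistrib inner_diff_right
      flip: matrix_vector_mul_assoc)

lemma star_op_blk11_le: "loewner_le (blk11 (star_op T1 T2)) (blk11 T1)"
  unfolding loewner_le_def star11 using coercive_matrix_inv(1)[OF coer r] by simp

lemma star_op_blk22_le: "loewner_le (blk22 (star_op T1 T2)) (blk22 T2)"
  unfolding loewner_le_def star22 using coercive_matrix_inv(1)[OF coer r] by simp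

lemma star_op_blk11_ge:
  "v \<bullet> (blk11 (star_op T1 T2) *v v) \<ge> v \<bullet> (blk11 T1 *v v) - (norm (blk21 T1 *v v))\<^sup>2 / r"
  unfolding star11 using coercive_matrix_inv(2)[OF coer r] by simp

lemma star_op_blk22_ge:
  "v \<bullet> (blk22 (star_op T1 T2) *v v) \<ge> v \<bullet> (blk22 T2 *v v) - (norm (blk12 T2 *v v))\<^sup>2 / r"
  unfolding star22 using coercive_matrix_inv(2)[OF coer r] by simp

text \<open>The new block is minus \<open>blk21 T2 ** Inv ** blk21 T1\<close>: the left factor
  contributes \<open>s\<close> to the squared norm and \<open>Inv\<close> contributes
  \<open>1 / r\<^sup>2\<close>. The bound \<open>s\<close> is asked of \<open>T2\<close> alone, so
  \<open>T1\<close> may be any power of the sequence.\<close>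

lemma star_op_blk21_norm:
  assumes "\<And>v. (norm (blk21 T2 *v v))\<^sup>2 \<le> s * (norm v)\<^sup>2" "s > 0"
  shows "(norm (blk21 (star_op T1 T2) *v v))\<^sup>2 \<le> s / r\<^sup>2 * (norm (blk21 T1 *v v))\<^sup>2"
proof -
  have "blk21 (star_op T1 T2) *v v = - (blk21 T2 *v (Inv *v (blk21 T1 *v v)))"
    using matrix_vector_mult_diff_rdistrib[of 0 "blk21 T2 ** Inv ** blk21 T1" v]
    by (simp add: star_op_def Let_def matrix_vector_mul_assoc matrix_mul_assoc)
  then have "(norm (blk21 (star_op T1 T2) *v v))\<^sup>2 \<le> s * (norm (Inv *v (blk21 T1 *v v)))\<^sup>2"
    using assms(1) by simp
  also have "\<dots> \<le> s * (norm (blk21 T1 *v v) / r)\<^sup>2"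
    using coercive_matrix_inv(3)[OF coer r] assms(2) by (intro mult_left_mono power_mono) auto
  finally show ?thesis
    by (simp add: power_divide)
qed

lemma star_op_blk12_norm:
  assumes "\<And>v. (norm (blk12 T1 *v v))\<^sup>2 \<le> s * (norm v)\<^sup>2" "s > 0"
  shows "(norm (blk12 (star_op T1 T2) *v v))\<^sup>2 \<le> s / r\<^sup>2 * (norm (blk12 T2 *v v))\<^sup>2"
proof -
  have "blk12 (star_op T1 T2) *v v = - (blk12 T1 *v (Inv *v (blk12 T2 *v v)))"
    using matrix_vector_mult_diff_rdistrib[of 0 "blk12 T1 ** Inv ** blk12 T2" v]
    by (simp add: star_op_def Let_def matrix_vector_mul_assoc matrix_mul_assoc)
  then have "(norm (blk12 (star_op T1 T2) *v v))\<^sup>2 \<le> s * (norm (Inv *v (blk12 T2 *v v)))\<^sup>2"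
    using assms(1) by simp
  also have "\<dots> \<le> s * (norm (blk12 T2 *v v) / r)\<^sup>2"
    using coercive_matrix_inv(3)[OF coer r] assms(2) by (intro mult_left_mono power_mono) auto
  finally show ?thesis
    by (simp add: power_divide)
qed

end

section \<open>Bounds along star powers\<close>

text \<open>By symmetry the products of the off-diagonal blocks are Gram matrices, so the first two
  hypotheses are bounds on operator norms.\<close>

lemma Theta_hyps_norm:
  assumes "Theta_hyps s l T" "transpose T = T"
  shows "(norm (blk21 T *v v))\<^sup>2 \<le> s * (norm v)\<^sup>2" "(norm (blk12 T *v v))\<^sup>2 \<le> s * (norm v)\<^sup>2"
proof -
  have "v \<bullet> ((blk12 T ** blk21 T) *v v) = (norm (blk21 T *v v))\<^sup>2"
    using inner_transpose_mult_vec[of v "blk21 T"] symmetric_blocks(3)[OF assms(2)]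
    by (simp add: power2_norm_eq_inner flip: matrix_vector_mul_assoc)
  moreover have "v \<bullet> ((blk21 T ** blk12 T) *v v) = (norm (blk12 T *v v))\<^sup>2"
    using inner_transpose_mult_vec[of v "blk12 T"] symmetric_blocks(4)[OF assms(2)]
    by (simp add: power2_norm_eq_inner flip: matrix_vector_mul_assoc)
  ultimately show "(norm (blk21 T *v v))\<^sup>2 \<le> s * (norm v)\<^sup>2" "(norm (blk12 T *v v))\<^sup>2 \<le> s * (norm v)\<^sup>2"
    using assms(1) unfolding Theta_hyps_def loewner_le_def inner_mat_vec by metis+
qed

text \<open>Both recurrences are used: \<open>right\<close> controls \<open>blk21\<close> and
  \<open>blk11\<close>, while \<open>left\<close> controls \<open>blk12\<close> and
  \<open>blk22\<close>. In each case the factor \<open>U 0\<close> supplies the fixed bound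
  \<open>s\<close>.\<close>

lemma star_power_bounds:
  fixes U :: "nat \<Rightarrow> real^('n::finite+'n)^('n+'n)" and s l r :: real
  assumes sym: "\<And>j. transpose (U j) = U j"
    and right: "\<And>j. U (Suc j) = star_op (U j) (U 0)"
    and left: "\<And>j. U (Suc j) = star_op (U 0) (U j)"
    and hyps: "Theta_hyps s l (U 0)"
    and s: "s > 0" and r: "r > 0" and c1: "s / r\<^sup>2 < 1"
    and c2: "r \<le> l - 2 * (s / r) / (1 - s / r\<^sup>2)"
  shows "loewner_le (mat r) (blk11 (U j) + blk22 (U j))"
    and "loewner_le (mat r) (blk22 (U 0) + blk11 (U j))"
    and "loewner_le (mat r) (blk22 (U j) + blk11 (U 0))"
proof -
  define q where "q = s / r\<^sup>2"
  \<comment> \<open>\<open>C\<close> bounds the total drop of one diagonal block. Since two blocks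
    may drop, \<open>c2\<close> is exactly \<open>r \<le> l - 2 * C\<close>.\<close>
  define C where "C = (s / r) / (1 - q)"
  have q: "0 < q" "q < 1"
    using s r c1 by (auto simp: q_def)
  have C: "C > 0" "r \<le> l - 2 * C"
    using s r q c2 by (simp_all add: C_def q_def)
  have geo: "(s / r) * (\<Sum>i<n. q ^ i) \<le> C" for n
  proof -
    have "(\<Sum>i<n. q ^ i) \<le> 1 / (1 - q)"
      using q by (simp add: sum_gp_strict divide_right_mono)
    then have "(s / r) * (\<Sum>i<n. q ^ i) \<le> (s / r) * (1 / (1 - q))"
      using s r by (intro mult_left_mono) auto
    then show ?thesis
      by (simp add: C_def)
  qed
  have hl: "l * (norm v)\<^sup>2 \<le> v \<bullet> (blk11 (U 0) *v v) + v \<bullet> (blk22 (U 0) *v v)" for v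
    using hyps by (simp add: Theta_hyps_def loewner_le_def inner_mat_vec
        matrix_vector_mult_add_rdistrib inner_add_right)
  define lo where "lo j \<longleftrightarrow>
      (\<forall>v. v \<bullet> (blk11 (U 0) *v v) - C * (norm v)\<^sup>2 \<le> v \<bullet> (blk11 (U j) *v v)) \<and>
      (\<forall>v. v \<bullet> (blk22 (U 0) *v v) - C * (norm v)\<^sup>2 \<le> v \<bullet> (blk22 (U j) *v v))" for j
  have rC: "r * (norm v)\<^sup>2 \<le> l * (norm v)\<^sup>2 - 2 * (C * (norm v)\<^sup>2)" "0 \<le> C * (norm v)\<^sup>2" for v :: "real^'n"
    using mult_right_mono[OF C(2), of "(norm v)\<^sup>2"] C(1) by (simp_all add: algebra_simps)
  have coer: "loewner_le (mat r) (blk22 (U 0) + blk11 (U j))"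
    "loewner_le (mat r) (blk22 (U j) + blk11 (U 0))"
    "loewner_le (mat r) (blk11 (U j) + blk22 (U j))" if "lo j" for j
  proof -
    have 1: "v \<bullet> (blk11 (U 0) *v v) - C * (norm v)\<^sup>2 \<le> v \<bullet> (blk11 (U j) *v v)"
      "v \<bullet> (blk22 (U 0) *v v) - C * (norm v)\<^sup>2 \<le> v \<bullet> (blk22 (U j) *v v)" for v
      using that by (auto simp: lo_def)
    show "loewner_le (mat r) (blk22 (U 0) + blk11 (U j))"
      "loewner_le (mat r) (blk22 (U j) + blk11 (U 0))"
      "loewner_le (mat r) (blk11 (U j) + blk22 (U j))"
      unfolding loewner_le_def inner_mat_vec matrix_vector_mult_add_rdistrib inner_add_right
      using 1 rC hl by (smt (verit))+
  qed
  \<comment> \<open>The invariant carries the partial geometric sums: the weaker bound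
    \<open>lo\<close> with the constant \<open>C\<close> would not reproduce itself in the induction
    step.\<close>
  define P where "P j \<longleftrightarrow>
      (\<forall>v. (norm (blk21 (U j) *v v))\<^sup>2 \<le> s * q ^ j * (norm v)\<^sup>2) \<and>
      (\<forall>v. (norm (blk12 (U j) *v v))\<^sup>2 \<le> s * q ^ j * (norm v)\<^sup>2) \<and>
      (\<forall>v. v \<bullet> (blk11 (U 0) *v v) - (s / r) * (\<Sum>i<j. q ^ i) * (norm v)\<^sup>2 \<le> v \<bullet> (blk11 (U j) *v v)) \<and>
      (\<forall>v. v \<bullet> (blk22 (U 0) *v v) - (s / r) * (\<Sum>i<j. q ^ i) * (norm v)\<^sup>2 \<le> v \<bullet> (blk22 (U j) *v v))" for j
  have P_lo: "lo j" if "P j" for j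
    unfolding lo_def
  proof (intro conjI allI)
    fix v :: "real^'n"
    have "(s / r) * (\<Sum>i<j. q ^ i) * (norm v)\<^sup>2 \<le> C * (norm v)\<^sup>2"
      by (intro mult_right_mono geo) simp
    with that show "v \<bullet> (blk11 (U 0) *v v) - C * (norm v)\<^sup>2 \<le> v \<bullet> (blk11 (U j) *v v)"
      "v \<bullet> (blk22 (U 0) *v v) - C * (norm v)\<^sup>2 \<le> v \<bullet> (blk22 (U j) *v v)"
      unfolding P_def by (smt (verit))+
  qed
  have "P j" for j
  proof (induction j)
    case 0
    show ?case
      using Theta_hyps_norm[OF hyps sym] by (simp add: P_def)
  next
    case (Suc j)
    note coer = coer[OF P_lo[OF Suc]]
    have n21: "(norm (blk21 (U j) *v v))\<^sup>2 \<le> s * q ^ j * (norm v)\<^sup>2" for v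
      using Suc by (simp add: P_def)
    have n12: "(norm (blk12 (U j) *v v))\<^sup>2 \<le> s * q ^ j * (norm v)\<^sup>2" for v
      using Suc by (simp add: P_def)
    show ?case
      unfolding P_def
    proof (intro conjI allI)
      fix v :: "real^'n"
      have "(norm (blk21 (U (Suc j)) *v v))\<^sup>2 \<le> q * (norm (blk21 (U j) *v v))\<^sup>2"
        using star_op_blk21_norm[OF sym sym coer(2) r Theta_hyps_norm(1)[OF hyps sym] s]
        by (simp add: right q_def)
      also have "\<dots> \<le> q * (s * q ^ j * (norm v)\<^sup>2)"
        using q by (intro mult_left_mono n21) auto
      finally show "(norm (blk21 (U (Suc j)) *v v))\<^sup>2 \<le> s * q ^ Suc j * (norm v)\<^sup>2"
        by (simp add: algebra_simps)
      have "(norm (blk12 (U (Suc j)) *v v))\<^sup>2 \<le> q * (norm (blk12 (U j) *v v))\<^sup>2"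
        using star_op_blk12_norm[OF sym sym coer(1) r Theta_hyps_norm(2)[OF hyps sym] s]
        by (simp add: left q_def)
      also have "\<dots> \<le> q * (s * q ^ j * (norm v)\<^sup>2)"
        using q by (intro mult_left_mono n12) auto
      finally show "(norm (blk12 (U (Suc j)) *v v))\<^sup>2 \<le> s * q ^ Suc j * (norm v)\<^sup>2"
        by (simp add: algebra_simps)
      have "v \<bullet> (blk11 (U j) *v v) - (norm (blk21 (U j) *v v))\<^sup>2 / r \<le> v \<bullet> (blk11 (U (Suc j)) *v v)"
        using star_op_blk11_ge[OF sym sym coer(2) r] by (simp add: right)
      moreover have "(norm (blk21 (U j) *v v))\<^sup>2 / r \<le> s * q ^ j * (norm v)\<^sup>2 / r"
        using r by (intro divide_right_mono n21) auto
      moreover have "v \<bullet> (blk11 (U 0) *v v) - (s / r) * (\<Sum>i<j. q ^ i) * (norm v)\<^sup>2 \<le> v \<bullet> (blk11 (U j) *v v)"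
        using Suc by (simp add: P_def)
      ultimately show "v \<bullet> (blk11 (U 0) *v v) - (s / r) * (\<Sum>i<Suc j. q ^ i) * (norm v)\<^sup>2
          \<le> v \<bullet> (blk11 (U (Suc j)) *v v)"
        by (simp add: algebra_simps add_divide_distrib)
      have "v \<bullet> (blk22 (U j) *v v) - (norm (blk12 (U j) *v v))\<^sup>2 / r \<le> v \<bullet> (blk22 (U (Suc j)) *v v)"
        using star_op_blk22_ge[OF sym sym coer(1) r] by (simp add: left)
      moreover have "(norm (blk12 (U j) *v v))\<^sup>2 / r \<le> s * q ^ j * (norm v)\<^sup>2 / r"
        using r by (intro divide_right_mono n12) auto
      moreover have "v \<bullet> (blk22 (U 0) *v v) - (s / r) * (\<Sum>i<j. q ^ i) * (norm v)\<^sup>2 \<le> v \<bullet> (blk22 (U j) *v v)"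
        using Suc by (simp add: P_def)
      ultimately show "v \<bullet> (blk22 (U 0) *v v) - (s / r) * (\<Sum>i<Suc j. q ^ i) * (norm v)\<^sup>2
          \<le> v \<bullet> (blk22 (U (Suc j)) *v v)"
        by (simp add: algebra_simps add_divide_distrib)
    qed
  qed
  then show "loewner_le (mat r) (blk11 (U j) + blk22 (U j))"
    "loewner_le (mat r) (blk22 (U 0) + blk11 (U j))"
    "loewner_le (mat r) (blk22 (U j) + blk11 (U 0))"
    using coer P_lo by blast+
qed

section \<open>Convergence of a star semigroup\<close>

text \<open>With \<open>K\<close> the maximum over the first period, each full period contributes a
  factor \<open>q\<close>, so \<open>f k\<close> is at most
  \<open>K * q ^ (k div N)\<close>.\<close>

lemma LIMSEQ_zero_of_periodic_contraction:
  fixes f :: "nat \<Rightarrow> real"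
  assumes nonneg: "\<And>k. 0 \<le> f k" and N: "N > 0" and q: "0 \<le> q" "q < 1"
    and step: "\<And>k. f (k + N) \<le> q * f k"
  shows "f \<longlonglongrightarrow> 0"
proof -
  define K where "K = Max (f ` {..<N})"
  have "f k \<le> K * q ^ (k div N)" for k
  proof (induction k rule: less_induct)
    case (less k)
    show ?case
    proof (cases "k < N")
      case True
      then show ?thesis by (simp add: K_def)
    next
      case False
      have "f k \<le> q * f (k - N)"
        using step[of "k - N"] False by simp
      also have "\<dots> \<le> q * (K * q ^ ((k - N) div N))"
        using False N q less.IH[of "k - N"] by (intro mult_left_mono) auto
      also have "\<dots> = K * q ^ (k div N)"
        using False N by (simp add: le_div_geq)
      finally show ?thesis .
    qed
  qed
  moreover have "(\<lambda>k. K * q ^ (k div N)) \<longlonglongrightarrow> K * 0"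
    using N q
    by (intro tendsto_intros filterlim_compose[OF LIMSEQ_power_zero] filterlim_at_top_div_const_nat) auto
  ultimately show ?thesis
    using tendsto_sandwich[of "\<lambda>_. 0" f sequentially "\<lambda>k. K * q ^ (k div N)" 0] nonneg by simp
qed

text \<open>For \<open>N = 1\<close> the diagonal blocks decrease because of \<open>star\<close>
  itself. For \<open>N > 1\<close>, \<open>star\<close> only compares indices at least
  \<open>N\<close> apart, so one-step monotonicity enters as the hypothesis
  \<open>mono\<close>.\<close>

lemma conv_blockdiag_star_semigroup:
  fixes T :: "nat \<Rightarrow> real^('n::finite+'n)^('n+'n)" and s l r :: real
  assumes N: "N > 0"
    and sym: "\<And>k. k \<ge> N \<Longrightarrow> transpose (T k) = T k"
    and star: "\<And>k1 k2. k1 \<ge> N \<Longrightarrow> k2 \<ge> N \<Longrightarrow> T (k1 + k2) = star_op (T k1) (T k2)"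
    and mono: "N > 1 \<Longrightarrow> (\<forall>k\<ge>N. loewner_le (blk11 (T (Suc k))) (blk11 (T k)) \<and>
                              loewner_le (blk22 (T (Suc k))) (blk22 (T k)))"
    and hyps: "Theta_hyps s l (T N)"
    and s: "s > 0" and r: "r > 0" and c1: "s / r\<^sup>2 < 1"
    and c2: "r \<le> l - 2 * (s / r) / (1 - s / r\<^sup>2)"
  shows "conv_blockdiag r T"
proof -
  define U where "U j = T (Suc j * N)" for j
  have U: "U (Suc j) = star_op (U j) (U 0)" "U (Suc j) = star_op (U 0) (U j)" for j
    using star[of "Suc j * N" N] star[of N "Suc j * N"] by (simp_all add: U_def add.commute)
  have symU: "transpose (U j) = U j" for j
    by (simp add: U_def sym)
  have hypsU: "Theta_hyps s l (U 0)"
    using hyps by (simp add: U_def)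
  note bounds = star_power_bounds[OF symU U hypsU s r c1 c2]
  have dec: "loewner_le (blk11 (T (Suc k))) (blk11 (T k))"
    "loewner_le (blk22 (T (Suc k))) (blk22 (T k))" if "k \<ge> N" for k
  proof -
    have "loewner_le (blk11 (T (Suc k))) (blk11 (T k)) \<and> loewner_le (blk22 (T (Suc k))) (blk22 (T k))"
    proof (cases "N = 1")
      case True
      \<comment> \<open>\<open>U\<close> is shifted by one; the subtraction is genuine because
        \<open>k \<ge> 1\<close>.\<close>
      then have "T k = U (k - 1)" "T (Suc k) = U (Suc (k - 1))"
        using that by (auto simp: U_def)
      then show ?thesis
        using star_op_blk11_le[OF symU symU bounds(3) r, of "k - 1"]
          star_op_blk22_le[OF symU symU bounds(2) r, of "k - 1"]
        by (metis U)
    next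
      case False
      then show ?thesis using mono N that by simp
    qed
    then show "loewner_le (blk11 (T (Suc k))) (blk11 (T k))"
      "loewner_le (blk22 (T (Suc k))) (blk22 (T k))" by auto
  qed
  have dec': "loewner_le (blk11 (T k')) (blk11 (T k))" "loewner_le (blk22 (T k')) (blk22 (T k))"
    if "k' \<ge> k" "k \<ge> N" for k k'
    using that(1)
  proof (induction rule: dec_induct)
    case base
    { case 1 show ?case by (simp add: loewner_le_def) next
      case 2 show ?case by (simp add: loewner_le_def) }
  next
    case (step m)
    { case 1 show ?case using step dec(1)[of m] that(2) loewner_le_trans by (metis le_trans) next
      case 2 show ?case using step dec(2)[of m] that(2) loewner_le_trans by (metis le_trans) }
  qed
  have coer: "loewner_le (mat r) (blk22 (T k) + blk11 (T k'))" if "k \<ge> N" "k' \<ge> N" for k k'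
    unfolding loewner_le_def
  proof
    fix v :: "real^'n"
    \<comment> \<open>The index \<open>Suc j * N\<close> is beyond both \<open>k\<close> and
      \<open>k'\<close>, so monotonicity bounds the mixed sum below by the sum of the diagonal
      blocks of the single matrix \<open>U j\<close>.\<close>
    define j where "j = k + k'"
    have "Suc j \<le> Suc j * N"
      using mult_le_mono2[of 1 N "Suc j"] N by simp
    then have "Suc j * N \<ge> k" "Suc j * N \<ge> k'"
      unfolding j_def by linarith+
    then have "v \<bullet> (blk22 (U j) *v v) \<le> v \<bullet> (blk22 (T k) *v v)"
      "v \<bullet> (blk11 (U j) *v v) \<le> v \<bullet> (blk11 (T k') *v v)"
      using dec' that unfolding U_def loewner_le_def by blast+
    then show "v \<bullet> (mat r *v v) \<le> v \<bullet> ((blk22 (T k) + blk11 (T k')) *v v)"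
      using bounds(1)[of j] unfolding loewner_le_def matrix_vector_mult_add_rdistrib inner_add_right
      by (smt (verit))
  qed
  \<comment> \<open>Freezing one index at \<open>N\<close> in \<open>coer\<close> leaves a fixed
    lower bound for each diagonal block separately.\<close>
  have low: "loewner_le (mat r - blk22 (T N)) (blk11 (T (k + N)))"
    "loewner_le (mat r - blk11 (T N)) (blk22 (T (k + N)))" for k
    using coer[of N "k + N"] coer[of "k + N" N]
    unfolding loewner_le_def matrix_vector_mult_add_rdistrib inner_add_right
      matrix_vector_mult_diff_rdistrib inner_diff_right
    by (simp_all add: algebra_simps)
  obtain L11 where L11: "(\<lambda>k. blk11 (T (k + N))) \<longlonglongrightarrow> L11"
    by (rule loewner_decseq_convergent[of "\<lambda>k. blk11 (T (k + N))", OF _ _ low(1)])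
      (auto simp: sym symmetric_blocks dec)
  obtain L22 where L22: "(\<lambda>k. blk22 (T (k + N))) \<longlonglongrightarrow> L22"
    by (rule loewner_decseq_convergent[of "\<lambda>k. blk22 (T (k + N))", OF _ _ low(2)])
      (auto simp: sym symmetric_blocks dec)
  \<comment> \<open>The contraction acts on the vectors \<open>blk21 (T (k + N)) *v v\<close>;
    taking axis vectors for \<open>v\<close> then gives the entries.\<close>
  have "(\<lambda>k. blk21 (T (k + N)) *v v) \<longlonglongrightarrow> 0" for v
  proof -
    have "(\<lambda>k. (norm (blk21 (T (k + N)) *v v))\<^sup>2) \<longlonglongrightarrow> 0"
    proof (rule LIMSEQ_zero_of_periodic_contraction[OF _ N _ c1])
      show "(norm (blk21 (T (k + N + N)) *v v))\<^sup>2 \<le> s / r\<^sup>2 * (norm (blk21 (T (k + N)) *v v))\<^sup>2" for k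
        using star_op_blk21_norm[OF sym sym coer r Theta_hyps_norm(1)[OF hyps sym] s, of "k + N" v]
          star[of "k + N" N]
        by simp
    qed (use s in auto)
    from tendsto_real_sqrt[OF this] show ?thesis
      by (simp add: tendsto_norm_zero_iff)
  qed
  then have entry: "(\<lambda>k. (blk21 (T (k + N)) *v axis j 1) $ i) \<longlonglongrightarrow> 0 $ i" for i j
    by (rule tendsto_vec_nth)
  have L21: "(\<lambda>k. blk21 (T (k + N))) \<longlonglongrightarrow> 0"
    using entry by (intro vec_tendstoI) (simp add: matrix_vector_mul_component inner_axis)
  have L12: "(\<lambda>k. blk12 (T (k + N))) \<longlonglongrightarrow> 0"
  proof -
    have "blk12 (T (k + N)) = transpose (blk21 (T (k + N)))" for k
      by (rule symmetric_blocks(3)[OF sym]) simp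
    then show ?thesis
      using entry by (intro vec_tendstoI)
        (simp add: matrix_vector_mul_component inner_axis transpose_def)
  qed
  have "(\<lambda>k. T (k + N)) \<longlonglongrightarrow> mk_blocks L11 0 0 L22"
    using tendsto_mk_blocks[OF L11 L12 L21 L22] by (simp add: mk_blocks_blk)
  then have "T \<longlonglongrightarrow> mk_blocks L11 0 0 L22"
    by (rule LIMSEQ_offset)
  moreover have "loewner_le (mat r) (L11 + L22)"
    unfolding loewner_le_def
  proof
    fix v :: "real^'n"
    have bl: "bounded_linear (\<lambda>X :: real^'n^'n. v \<bullet> (X *v v))"
      by (intro linear_conv_bounded_linear[THEN iffD1] linearI)
        (simp_all add: matrix_vector_mult_add_rdistrib inner_add_right scaleR_matrix_vector_assoc[symmetric])
    have "(\<lambda>k. v \<bullet> ((blk11 (T (k + N)) + blk22 (T (k + N))) *v v)) \<longlonglongrightarrow> v \<bullet> ((L11 + L22) *v v)"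
      by (intro bounded_linear.tendsto[OF bl] tendsto_add L11 L22)
    moreover have "v \<bullet> (mat r *v v) \<le> v \<bullet> ((blk11 (T (k + N)) + blk22 (T (k + N))) *v v)" for k
      using coer[of "k + N" "k + N"] by (simp add: loewner_le_def add.commute)
    ultimately show "v \<bullet> (mat r *v v) \<le> v \<bullet> ((L11 + L22) *v v)"
      by (intro LIMSEQ_le_const) auto
  qed
  ultimately show ?thesis
    unfolding conv_blockdiag_def by blast
qed

section \<open>Value functions: uniqueness of the matrix and monotonicity for
  \<open>i = 3\<close>\<close>

lemma stack_surj: "\<exists>y z. stack y z = x"
  by (rule exI[of _ "\<chi> i. x $ Inl i"], rule exI[of _ "\<chi> i. x $ Inr i"])
    (simp add: stack_def vec_eq_iff split: sum.split)

text \<open>The definite description is justified by uniqueness: every vector is stacked, so two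
  candidates have the same quadratic form, and symmetry makes them equal by polarization.\<close>

lemma is_Theta_Theta:
  assumes "is_Theta k i \<Phi> \<gamma> A B M T"
  shows "is_Theta k i \<Phi> \<gamma> A B M (Theta k i \<Phi> \<gamma> A B M)"
  unfolding Theta_def
proof (rule theI[where P = "is_Theta k i \<Phi> \<gamma> A B M", OF assms])
  fix T' assume T': "is_Theta k i \<Phi> \<gamma> A B M T'"
  have "x \<bullet> (T' *v x) = x \<bullet> (T *v x)" for x
    using stack_surj[of x] assms T' unfolding is_Theta_def by force
  then show "T' = T"
    using symmetric_entry_polarization assms T' unfolding is_Theta_def vec_eq_iff by metis
qed

text \<open>In \<^typ>\<open>ereal\<close>, \<^prop>\<open>-\<infinity> - (-\<infinity>) = (\<infinity>::ereal)\<close>, so the supremum defining \<^const>\<open>Bki\<close>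
  collapses to its term at \<open>x = y\<close> only because finiteness of \<^const>\<open>Bki\<close> excludes the value
  \<open>-\<infinity>\<close> of \<^const>\<open>Ski\<close>.\<close>
lemma Bki_3_eq_Ski:
  assumes T: "is_Theta k 3 \<Phi> \<gamma> A B M T"
  shows "Bki k 3 \<Phi> \<gamma> A B M y z = Ski k 3 \<Phi> \<gamma> A B M y z"
proof -
  let ?S = "\<lambda>x. Ski k 3 \<Phi> \<gamma> A B M x z"
  have fin: "\<bar>Bki k 3 \<Phi> \<gamma> A B M y z\<bar> \<noteq> \<infinity>" for y
    using T by (simp add: is_Theta_def)
  have nmi: "?S x \<noteq> - \<infinity>" for x
  proof
    assume S: "?S x = - \<infinity>"
    have "\<infinity> = psi 3 M x x - ?S x"
      using S by (simp add: psi_def)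
    also have "\<dots> \<le> (SUP x'. psi 3 M x' x - ?S x')"
      by (rule SUP_upper) simp
    finally show False
      using fin[of x] by (simp add: Bki_def)
  qed
  have "(SUP x. psi 3 M x y - ?S x) = - ?S y"
  proof (rule antisym)
    show "(SUP x. psi 3 M x y - ?S x) \<le> - ?S y"
    proof (rule SUP_least)
      fix x
      show "psi 3 M x y - ?S x \<le> - ?S y"
        using nmi[of x] by (cases "?S x") (auto simp: psi_def)
    qed
    have "- ?S y = psi 3 M y y - ?S y"
      by (simp add: psi_def)
    also have "\<dots> \<le> (SUP x. psi 3 M x y - ?S x)"
      by (rule SUP_upper) simp
    finally show "- ?S y \<le> (SUP x. psi 3 M x y - ?S x)" .
  qed
  then show ?thesis
    by (simp add: Bki_def)
qed

lemma S1_mono: "\<phi> \<le> \<phi>' \<Longrightarrow> S1 \<Phi> \<gamma> A B \<phi> \<le> S1 \<Phi> \<gamma> A B \<phi>'"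
  unfolding le_fun_def S1_def by (intro allI SUP_mono' add_left_mono) auto

lemma Sk_mono: "\<phi> \<le> \<phi>' \<Longrightarrow> Sk k \<Phi> \<gamma> A B \<phi> \<le> Sk k \<Phi> \<gamma> A B \<phi>'"
  unfolding Sk_def by (induction k) (auto intro: S1_mono)

text \<open>The control \<open>w = 0\<close> keeps the state at the origin with zero running
  payoff.\<close>

lemma S1_zero_ge: "\<phi> 0 \<le> S1 \<Phi> \<gamma> A B \<phi> 0"
proof -
  have "\<phi> 0 = ereal (1/2 * (0 \<bullet> (\<Phi> *v 0)) - \<gamma>\<^sup>2 / 2 * (norm (0::real^'b))\<^sup>2) + \<phi> (A *v 0 + B *v 0)"
    by (simp flip: zero_ereal_def)
  also have "\<dots> \<le> S1 \<Phi> \<gamma> A B \<phi> 0"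
    unfolding S1_def by (rule SUP_upper) simp
  finally show ?thesis .
qed

text \<open>A trajectory may idle at the origin at no cost, before leaving it or after reaching it.\<close>
lemma Ski_3_Suc_ge:
  shows "Ski k 3 \<Phi> \<gamma> A B M x 0 \<le> Ski (Suc k) 3 \<Phi> \<gamma> A B M x 0"
    and "Ski k 3 \<Phi> \<gamma> A B M 0 z \<le> Ski (Suc k) 3 \<Phi> \<gamma> A B M 0 z"
proof -
  let ?\<psi> = "\<lambda>x. psi 3 M x 0"
  \<comment> \<open>Only \<open>x = 0\<close> matters, since \<open>?\<psi>\<close> is
    \<open>-\<infinity>\<close> elsewhere. Applying \<open>Sk\<close> to this inequality inserts the
    idle step at the end of the trajectory.\<close>
  have "?\<psi> \<le> S1 \<Phi> \<gamma> A B ?\<psi>"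
  proof (rule le_funI)
    show "psi 3 M x 0 \<le> S1 \<Phi> \<gamma> A B ?\<psi> x" for x
      using S1_zero_ge[of ?\<psi> \<Phi> \<gamma> A B] by (cases "x = 0") (simp_all add: psi_def)
  qed
  from Sk_mono[OF this, of k \<Phi> \<gamma> A B] show "Ski k 3 \<Phi> \<gamma> A B M x 0 \<le> Ski (Suc k) 3 \<Phi> \<gamma> A B M x 0"
    by (simp add: Ski_def Sk_def le_fun_def funpow_swap1)
  \<comment> \<open>Here the extra \<open>S1\<close> is outermost, so the idle step comes
    first.\<close>
  show "Ski k 3 \<Phi> \<gamma> A B M 0 z \<le> Ski (Suc k) 3 \<Phi> \<gamma> A B M 0 z"
    using S1_zero_ge by (simp add: Ski_def Sk_def)
qed

lemma sum_UNIV_sum: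
  "(\<Sum>i\<in>UNIV. f i) = (\<Sum>i\<in>UNIV. f (Inl i)) + (\<Sum>i\<in>UNIV. f (Inr i))"
  for f :: "'a::finite + 'b::finite \<Rightarrow> 'c::comm_monoid_add"
  using sum.Plus[of UNIV UNIV f] by simp

lemma inner_stack_blk:
  "stack y 0 \<bullet> (T *v stack y 0) = y \<bullet> (blk11 T *v y)"
  "stack 0 z \<bullet> (T *v stack 0 z) = z \<bullet> (blk22 T *v z)"
  by (simp_all add: inner_vec_def stack_def matrix_vector_mult_def blk11_def blk22_def
      sum_UNIV_sum)

text \<open>Setting one of the two arguments to zero isolates a diagonal block, and the factor
  \<open>-1/2\<close> turns the increase of the payoff in \<open>k\<close> into a decrease of the
  block.\<close>

lemma Theta_3_decreasing:
  assumes "is_Theta k 3 \<Phi> \<gamma> A B M T" "is_Theta (Suc k) 3 \<Phi> \<gamma> A B M T'"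
  shows "loewner_le (blk11 T') (blk11 T)" "loewner_le (blk22 T') (blk22 T)"
proof -
  have T: "Ski k 3 \<Phi> \<gamma> A B M y z = ereal (- (1/2) * (stack y z \<bullet> (T *v stack y z)))"
    "Ski (Suc k) 3 \<Phi> \<gamma> A B M y z = ereal (- (1/2) * (stack y z \<bullet> (T' *v stack y z)))" for y z
    using assms Bki_3_eq_Ski by (metis is_Theta_def)+
  show "loewner_le (blk11 T') (blk11 T)" "loewner_le (blk22 T') (blk22 T)"
    using Ski_3_Suc_ge[of k \<Phi> \<gamma> A B M]
    by (simp_all add: loewner_le_def T inner_stack_blk)
qed

theorem theorem4p4:
  fixes A \<Phi> M :: "real^'n^'n" and B :: "real^'m^'n" and \<gamma> \<sigma> lam \<rho> :: real and i :: nat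
  assumes ctrb: "controllable A B"
    and rankB: "rank B = CARD('m)" and mn: "CARD('m) \<le> CARD('n)"
    and Phi: "pos_def \<Phi>" and Mpd: "pos_def M"
    and i: "i \<in> {1, 2, 3}"
    and sig: "\<sigma> > 0" and lam: "lam > 0" and rho: "\<rho> > 0"
    and c1: "\<sigma> / \<rho>\<^sup>2 < 1"
    and c2: "\<rho> \<le> lam - 2 * (\<sigma> / \<rho>) / (1 - \<sigma> / \<rho>\<^sup>2)"
  shows
    "((i = 1 \<or> i = 2 \<or> (i = 3 \<and> CARD('m) = CARD('n))) \<and>
       standing 1 i \<Phi> \<gamma> A B M \<and> Theta_hyps \<sigma> lam (Theta 1 i \<Phi> \<gamma> A B M)
       \<longrightarrow> conv_blockdiag \<rho> (\<lambda>k. Theta k i \<Phi> \<gamma> A B M))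
     \<and>
     ((i = 3 \<and> CARD('m) < CARD('n)) \<and>
       standing CARD('n) 3 \<Phi> \<gamma> A B M \<and> Theta_hyps \<sigma> lam (Theta CARD('n) 3 \<Phi> \<gamma> A B M)
       \<longrightarrow> conv_blockdiag \<rho> (\<lambda>k. Theta k 3 \<Phi> \<gamma> A B M))"
proof -
  \<comment> \<open>Both claims are instances, with \<open>N = 1\<close> and with
    \<open>N = CARD('n)\<close>. The alternative \<open>N = 1 \<or> i' = 3\<close> provides
    monotonicity whenever \<open>N > 1\<close>.\<close>
  have main: "conv_blockdiag \<rho> (\<lambda>k. Theta k i' \<Phi> \<gamma> A B M)"
    if N: "N > 0" and N3: "N = 1 \<or> i' = 3" and st: "standing N i' \<Phi> \<gamma> A B M"
      and hyps: "Theta_hyps \<sigma> lam (Theta N i' \<Phi> \<gamma> A B M)" for N i'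
  proof (rule conv_blockdiag_star_semigroup[where N = N, OF _ _ _ _ _ sig rho c1 c2])
    have Th: "is_Theta k i' \<Phi> \<gamma> A B M (Theta k i' \<Phi> \<gamma> A B M)" if "k \<ge> N" for k
      using st that is_Theta_Theta unfolding standing_def by blast
    show "transpose (Theta k i' \<Phi> \<gamma> A B M) = Theta k i' \<Phi> \<gamma> A B M" if "k \<ge> N" for k
      using Th[OF that] by (simp add: is_Theta_def)
    show "Theta (k1 + k2) i' \<Phi> \<gamma> A B M = star_op (Theta k1 i' \<Phi> \<gamma> A B M) (Theta k2 i' \<Phi> \<gamma> A B M)"
      if "k1 \<ge> N" "k2 \<ge> N" for k1 k2
      using st that by (simp add: standing_def)
    show "\<forall>k\<ge>N. loewner_le (blk11 (Theta (Suc k) i' \<Phi> \<gamma> A B M)) (blk11 (Theta k i' \<Phi> \<gamma> A B M)) \<and>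
        loewner_le (blk22 (Theta (Suc k) i' \<Phi> \<gamma> A B M)) (blk22 (Theta k i' \<Phi> \<gamma> A B M))"
      if "N > 1"
      using Theta_3_decreasing Th N3 that by (metis le_SucI less_irrefl)
    show "Theta_hyps \<sigma> lam (Theta N i' \<Phi> \<gamma> A B M)"
      by (fact hyps)
    show "N > 0"
      by (fact N)
  qed
  show ?thesis
    using main[of 1 i] main[of "CARD('n)" 3] by simp
qed

end
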